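(* Let $n>1$ and let $n\ge k$ be positive integers such that $k\le(\sqrt{4n-3}+1)/2$. Then $$h(n,k)=n-\frac12(k^2-k).$$
   Context: $\mathbb{Z}_n=\mathbb{Z}/n\mathbb{Z}$ is the additive group of integers modulo $n$. Sequences are finite, and terms may repeat. For positive integers $n\ge k$, $h(n,k)$ is the least integer $h\ge k$ such that each sequence in $\mathbb{Z}_n$ with at least $k$ distinct terms and length $h$ contains a nonempty zero sum, that is, a nonempty subsequence (obtained by choosing a set of indices) whose sum is the zero element of $\mathbb{Z}_n$. *)

theory Defs
  imports Complex_Main "HOL-Algebra.Elementary_Groups" "HOL-Algebra.FiniteProduct"
begin

text \<open>The term at each index is used at most once, so a value repeated in \<open>xs\<close> may be
  used as often as it occurs. \<open>finprod\<close> is the sum in an additively written \<open>G\<close>; it is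
  meaningful when \<open>G\<close> is commutative and all terms lie in its carrier.\<close>

definition contains_nonempty_zero_sum :: "('a, 'b) monoid_scheme \<Rightarrow> 'a list \<Rightarrow> bool" where
  "contains_nonempty_zero_sum G xs \<longleftrightarrow>
     (\<exists>I \<subseteq> {..<length xs}. I \<noteq> {} \<and> finprod G (\<lambda>i. xs ! i) I = \<one>\<^bsub>G\<^esub>)"

text \<open>For \<open>1 \<le> k \<le> n\<close> the minimum is over a nonempty set: by the pigeonhole
  principle on partial sums, every sequence of length \<open>n\<close> in \<open>integer_mod_group n\<close>
  contains a nonempty zero sum.\<close>

definition h :: "nat \<Rightarrow> nat \<Rightarrow> nat" where
  "h n k = (LEAST l. k \<le> l \<and>
     (\<forall>xs. set xs \<subseteq> carrier (integer_mod_group n) \<and> card (set xs) \<ge> k \<and> length xs = l \<longrightarrow>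
        contains_nonempty_zero_sum (integer_mod_group n) xs))"

lemma finprod_integer_mod_group:
  assumes "n > 0" "finite I" "\<And>i. i \<in> I \<Longrightarrow> f i \<in> carrier (integer_mod_group n)"
  shows "finprod (integer_mod_group n) f I = (\<Sum>i\<in>I. f i) mod int n"
proof -
  interpret comm_group "integer_mod_group n" by simp
  show ?thesis
    using assms(2,3)
    by (induction I rule: finite_induct) (auto simp: Pi_def mod_add_right_eq)
qed

end

theory Submission
  imports Defs "HOL-Number_Theory.Cong"
begin

text \<open>
Let \<open>S\<close> be a zero-sum-free sequence modulo \<open>n\<close> of length greater than \<open>n / 2\<close>. By a theorem
of Savchev and Chen (\<open>long_zero_sum_free_coordinates\<close>) its terms are multiples \<open>x i * b\<close> of one
residue \<open>b\<close> with positive integers \<open>x i\<close> of sum less than \<open>n\<close>. If \<open>S\<close> has \<open>k\<close> distinct terms, then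
the \<open>x i\<close> have \<open>k\<close> distinct values, so their sum is at least the length of \<open>S\<close> plus
\<open>0 + 1 + \<dots> + (k - 1)\<close>, and the length is less than \<open>n - k (k - 1) / 2\<close>. The bound on
\<open>k\<close> says exactly that \<open>k\<^sup>2 - k + 1 \<le> n\<close>, so that \<open>n - k (k - 1) / 2\<close> exceeds \<open>n / 2\<close> and the
theorem applies to sequences of this length. Conversely, \<open>1, 2, \<dots>, k, 1, \<dots>, 1\<close> of any smaller
length has a total less than \<open>n\<close> and no zero sum.

The structure theorem comes from counting subset sums. Call a subsequence heavy if it has at least
twice as many subset sums (with the empty one) as terms; \<open>S\<close> itself is too long for that. When a
maximal heavy subsequence \<open>M\<close> is extended by a further term \<open>b\<close>, only one new subset sum arises, and
then the subset sums of \<open>M\<close> are closed under adding \<open>b\<close>, except at the total of \<open>M\<close>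
(\<open>closed_except_if_one_new_residue\<close>). Only one residue \<open>b\<close> can have this
property (\<open>closed_except_step_unique\<close>). So \<open>S\<close> arises from \<open>M\<close> by adding copies of one \<open>b\<close>; the
property passes to \<open>S\<close>, hence \<open>b\<close> does not depend on \<open>M\<close>, and no heavy subsequence contains
all copies of \<open>b\<close> (\<open>heavy_misses_direction\<close>).

Now collect terms, starting with the copies of \<open>b\<close>, as long as the subset sums form an interval
\<open>0, b, \<dots>, L b\<close>. A term that does not prolong the interval translates it to a disjoint set; together
with the collected terms it would form a heavy subsequence with all copies of \<open>b\<close>. So all
terms are collected.\<close>

section \<open>Subset sums modulo n\<close>

text \<open>A sequence is a family \<open>a\<close> of integers over a finite index set. The subset sums are
kept as a union of full residue classes of integers, so that translation by a term and reflection
are operations on integers without any reduction; only \<open>residue_count\<close> reduces.\<close>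
definition subset_sums :: "int \<Rightarrow> ('i \<Rightarrow> int) \<Rightarrow> 'i set \<Rightarrow> int set" where
  "subset_sums n a T = {x. \<exists>U\<subseteq>T. [x = sum a U] (mod n)}"

definition residue_count :: "int \<Rightarrow> int set \<Rightarrow> nat" where
  "residue_count n X = card ((\<lambda>x. x mod n) ` X)"

definition zero_sum_free :: "int \<Rightarrow> ('i \<Rightarrow> int) \<Rightarrow> 'i set \<Rightarrow> bool" where
  "zero_sum_free n a T \<longleftrightarrow> (\<forall>U\<subseteq>T. n dvd sum a U \<longrightarrow> U = {})"

lemma subset_sums_cong: "[x = y] (mod n) \<Longrightarrow> x \<in> subset_sums n a T \<Longrightarrow> y \<in> subset_sums n a T"
  unfolding subset_sums_def mem_Collect_eq by (metis cong_sym cong_trans)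

lemma sum_in_subset_sums: "U \<subseteq> T \<Longrightarrow> sum a U \<in> subset_sums n a T"
  unfolding subset_sums_def by auto

lemma zero_in_subset_sums: "0 \<in> subset_sums n a T"
  using sum_in_subset_sums[of "{}" T a n] by simp

lemma zero_sum_free_subset: "zero_sum_free n a S \<Longrightarrow> T \<subseteq> S \<Longrightarrow> zero_sum_free n a T"
  unfolding zero_sum_free_def by blast

lemma zero_sum_free_term: "zero_sum_free n a S \<Longrightarrow> i \<in> S \<Longrightarrow> \<not> n dvd a i"
  unfolding zero_sum_free_def by (drule spec[of _ "{i}"]) auto

lemma subset_sums_insert:
  assumes "finite T" "i \<notin> T"
  shows "subset_sums n a (insert i T) = subset_sums n a T \<union> (\<lambda>x. x + a i) ` subset_sums n a T"
proof (intro equalityI subsetI)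
  fix x assume "x \<in> subset_sums n a (insert i T)"
  then obtain U where U: "U \<subseteq> insert i T" "[x = sum a U] (mod n)"
    unfolding subset_sums_def by blast
  show "x \<in> subset_sums n a T \<union> (\<lambda>x. x + a i) ` subset_sums n a T"
  proof (cases "i \<in> U")
    case True
    have "finite U" using U(1) assms(1) by (meson finite_insert finite_subset)
    then have "sum a U = a i + sum a (U - {i})" using True by (simp add: sum.remove)
    then have "[x - a i = sum a (U - {i})] (mod n)"
      using U(2) by (metis add_diff_cancel_left' cong_diff cong_refl)
    moreover have "U - {i} \<subseteq> T" using U(1) by blast
    ultimately have "x - a i \<in> subset_sums n a T" unfolding subset_sums_def by blast
    then show ?thesis by (auto intro!: image_eqI[of _ _ "x - a i"])
  next
    case False
    then have "U \<subseteq> T" using U(1) by blast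
    then show ?thesis using U(2) unfolding subset_sums_def by blast
  qed
next
  fix x assume "x \<in> subset_sums n a T \<union> (\<lambda>x. x + a i) ` subset_sums n a T"
  then show "x \<in> subset_sums n a (insert i T)"
  proof
    assume "x \<in> subset_sums n a T"
    then show ?thesis unfolding subset_sums_def by blast
  next
    assume "x \<in> (\<lambda>x. x + a i) ` subset_sums n a T"
    then obtain y U where y: "x = y + a i" "U \<subseteq> T" "[y = sum a U] (mod n)"
      unfolding subset_sums_def by blast
    have "sum a (insert i U) = sum a U + a i"
      using y(2) assms by (subst sum.insert) (auto intro: finite_subset)
    then have "[x = sum a (insert i U)] (mod n)" using y by (simp add: cong_add_rcancel)
    moreover have "insert i U \<subseteq> insert i T" using y(2) by blast
    ultimately show ?thesis unfolding subset_sums_def by blast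
  qed
qed

text \<open>Passing to the complementary subset. This symmetry turns the fact that \<open>- a i\<close> is not a
subset sum into the fact that the full sum plus \<open>a i\<close> is not one.\<close>
lemma subset_sums_reflect:
  assumes "finite T" "x \<in> subset_sums n a T"
  shows "sum a T - x \<in> subset_sums n a T"
proof -
  obtain U where U: "U \<subseteq> T" "[x = sum a U] (mod n)"
    using assms(2) unfolding subset_sums_def by blast
  have "sum a (T - U) = sum a T - sum a U"
    using U(1) assms(1) by (simp add: sum_diff)
  then have "[sum a T - x = sum a (T - U)] (mod n)" using U(2) by (simp add: cong_diff)
  moreover have "T - U \<subseteq> T" by blast
  ultimately show ?thesis unfolding subset_sums_def by blast
qed

text \<open>Otherwise \<open>i\<close> would complete a subset with sum \<open>- a i\<close> to a nonempty zero sum.\<close>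
lemma neg_term_notin_subset_sums:
  assumes "finite T" "i \<notin> T" "zero_sum_free n a (insert i T)"
  shows "- a i \<notin> subset_sums n a T"
proof
  assume "- a i \<in> subset_sums n a T"
  then obtain U where U: "U \<subseteq> T" "[- a i = sum a U] (mod n)"
    unfolding subset_sums_def by blast
  have "sum a (insert i U) = a i + sum a U"
    using U(1) assms by (subst sum.insert) (auto intro: finite_subset)
  then have "n dvd sum a (insert i U)" using U(2)
    by (metis add.commute add.inverse_inverse cong_iff_dvd_diff cong_sym diff_conv_add_uminus)
  moreover have "insert i U \<subseteq> insert i T" using U(1) by blast
  ultimately show False using assms(3) unfolding zero_sum_free_def by blast
qed

text \<open>A new term always produces at least one new residue, namely the new full sum.\<close>
lemma sum_add_term_notin_subset_sums:
  assumes "finite T" "i \<notin> T" "zero_sum_free n a (insert i T)"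
  shows "sum a T + a i \<notin> subset_sums n a T"
  using subset_sums_reflect[OF assms(1), of "sum a T + a i" n a] neg_term_notin_subset_sums[OF assms]
  by auto

lemma finite_residue_image: "n > 0 \<Longrightarrow> finite ((\<lambda>x::int. x mod n) ` X)"
  by (rule finite_subset[of _ "{0..<n}"]) auto

lemma residue_count_mono: "n > 0 \<Longrightarrow> X \<subseteq> Y \<Longrightarrow> residue_count n X \<le> residue_count n Y"
  unfolding residue_count_def by (intro card_mono finite_residue_image image_mono)

lemma residue_count_le:
  assumes "n > 0" shows "int (residue_count n X) \<le> n"
proof -
  have "residue_count n X \<le> card {0..<n}"
    unfolding residue_count_def using assms by (intro card_mono) auto
  then show ?thesis using assms by simp
qed

lemma residue_count_shift: "residue_count n ((\<lambda>x. x + c) ` X) = residue_count n X"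
proof -
  have "(\<lambda>x. x mod n) ` (\<lambda>x. x + c) ` X = (\<lambda>r. (r + c) mod n) ` (\<lambda>x. x mod n) ` X"
    by (simp add: image_image mod_add_left_eq)
  moreover have "inj_on (\<lambda>r. (r + c) mod n) ((\<lambda>x. x mod n) ` X)"
  proof (rule inj_onI)
    fix r r' assume r: "r \<in> (\<lambda>x. x mod n) ` X" "r' \<in> (\<lambda>x. x mod n) ` X"
      and "(r + c) mod n = (r' + c) mod n"
    then have "[r = r'] (mod n)" unfolding cong_def[symmetric] by (simp add: cong_add_rcancel)
    then show "r = r'" using r unfolding cong_def by auto
  qed
  ultimately show ?thesis unfolding residue_count_def by (simp add: card_image)
qed

lemma residue_count_Un_disjoint:
  assumes "n > 0" "\<And>x y. x \<in> X \<Longrightarrow> y \<in> Y \<Longrightarrow> \<not> [x = y] (mod n)"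
  shows "residue_count n (X \<union> Y) = residue_count n X + residue_count n Y"
  unfolding residue_count_def image_Un using assms
  by (intro card_Un_disjoint finite_residue_image) (auto simp: cong_def)

lemma residue_count_singleton: "residue_count n {x} = 1"
  by (simp add: residue_count_def)

section \<open>Terms that create only one new residue\<close>

text \<open>A set of residues that is closed under adding \<open>b\<close> except at \<open>s\<close>, but with
\<open>s + b\<close> outside, consists of full cosets of the subgroup generated by \<open>b\<close> and one
progression with difference \<open>b\<close> that ends at \<open>s\<close>. The closure property is all that
is used of this picture.\<close>
definition closed_except :: "int \<Rightarrow> int set \<Rightarrow> int \<Rightarrow> int \<Rightarrow> bool" where
  "closed_except n X s b \<longleftrightarrow> (\<forall>x\<in>X. \<not> [x = s] (mod n) \<longrightarrow> x + b \<in> X)"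

text \<open>The new full sum \<open>sum a T + a i\<close> is the single new residue. An element \<open>x + a i\<close> outside
the old subset sums with \<open>x\<close> not congruent to \<open>sum a T\<close> would be a second one.\<close>
lemma closed_except_if_one_new_residue:
  assumes "n > 0" "finite T" "i \<notin> T" "zero_sum_free n a (insert i T)"
    and "residue_count n (subset_sums n a (insert i T)) \<le> residue_count n (subset_sums n a T) + 1"
  shows "closed_except n (subset_sums n a T) (sum a T) (a i)"
  unfolding closed_except_def
proof (intro ballI impI)
  let ?X = "subset_sums n a T"
  fix x assume x: "x \<in> ?X" "\<not> [x = sum a T] (mod n)"
  show "x + a i \<in> ?X"
  proof (rule ccontr)
    assume new: "x + a i \<notin> ?X"
    have "\<not> [x + a i = sum a T + a i] (mod n)" using x(2) by (simp add: cong_add_rcancel)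
    then have "residue_count n ({x + a i} \<union> {sum a T + a i}) = 2"
      using assms(1) by (subst residue_count_Un_disjoint) (auto simp: residue_count_singleton)
    moreover have "residue_count n (?X \<union> ({x + a i} \<union> {sum a T + a i}))
      = residue_count n ?X + residue_count n ({x + a i} \<union> {sum a T + a i})"
      using assms(1) new sum_add_term_notin_subset_sums[OF assms(2-4)]
      by (intro residue_count_Un_disjoint) (auto intro: subset_sums_cong)
    moreover have "residue_count n (?X \<union> ({x + a i} \<union> {sum a T + a i})) \<le> residue_count n (subset_sums n a (insert i T))"
      using subset_sums_insert[OF assms(2,3)] sum_in_subset_sums[of T T a n] x(1)
      by (intro residue_count_mono[OF assms(1)]) auto
    ultimately show False using assms(5) by linarith
  qed
qed

text \<open>Starting at \<open>0\<close>, steps of length \<open>b\<close> stay in \<open>X\<close> until they reach \<open>s\<close>,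
because otherwise they would reach \<open>- b\<close>. Hence \<open>0, b, \<dots>, j b\<close> with
\<open>j b = s\<close> lie in \<open>X\<close> and \<open>(j + 1) b\<close> does not. The first step by
\<open>c\<close> leads to \<open>c \<in> X\<close>. If \<open>c\<close> is a point \<open>t b\<close> of this progression with
\<open>t \<ge> 2\<close>, then the step by \<open>c\<close> from \<open>(j + 1 - t) b\<close> jumps over \<open>s\<close> to the excluded
point \<open>(j + 1) b\<close>. If it is not, then the whole coset of \<open>c\<close> modulo the multiples of \<open>b\<close>
lies in \<open>X\<close> and avoids \<open>s\<close>; steps by \<open>c\<close> carry this to the cosets of \<open>2 c, 3 c, \<dots>\<close>
and finally to the multiples of \<open>b\<close> themselves, among them \<open>- b\<close>.\<close>
lemma closed_except_step_unique:
  fixes n s b c :: int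
  assumes per: "\<And>x y. [x = y] (mod n) \<Longrightarrow> x \<in> X \<Longrightarrow> y \<in> X"
    and zero: "0 \<in> X" "\<not> [s = 0] (mod n)"
    and n: "n > 0" and c0: "\<not> n dvd c"
    and b: "closed_except n X s b" "- b \<notin> X"
    and c: "closed_except n X s c"
  shows "[b = c] (mod n)"
proof -
  have stepb: "x + b \<in> X" if "x \<in> X" "\<not> [x = s] (mod n)" for x
    using b(1) that unfolding closed_except_def by blast
  have stepc: "x + c \<in> X" if "x \<in> X" "\<not> [x = s] (mod n)" for x
    using c that unfolding closed_except_def by blast
  \<comment> \<open>The residue of \<open>- b\<close> is a natural multiple of \<open>b\<close>.\<close>
  have full: False if "\<And>i::nat. int i * b \<in> X"
  proof -
    have "[int (nat (n - 1)) * b = - b] (mod n)"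
      using n by (simp add: cong_iff_dvd_diff algebra_simps)
    then show False using per that b(2) by blast
  qed
  define j where "j = (LEAST j::nat. int (Suc j) * b \<notin> X)"
  have "\<exists>j::nat. int (Suc j) * b \<notin> X"
  proof (rule ccontr)
    assume *: "\<not> ?thesis"
    have "int i * b \<in> X" for i by (cases i) (use * zero in auto)
    then show False by (rule full)
  qed
  then have j_out: "int (Suc j) * b \<notin> X" unfolding j_def by (rule LeastI_ex)
  have j_in: "int i * b \<in> X" if "i \<le> j" for i
  proof (cases i)
    case 0 then show ?thesis using zero by simp
  next
    case (Suc i')
    then have "i' < j" using that by simp
    then show ?thesis unfolding Suc j_def using not_less_Least by blast
  qed
  have j_s: "[int j * b = s] (mod n)"
    using stepb[of "int j * b"] j_in[of j] j_out by (auto simp: algebra_simps)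
  have before_s: "\<not> [int i * b = s] (mod n)" if "i < j" for i
  proof
    assume "[int i * b = s] (mod n)"
    then have "[int j * b = int i * b] (mod n)" using j_s cong_sym cong_trans by blast
    then have "[int (j - i - 1) * b = - b] (mod n)"
      using that by (simp add: cong_iff_dvd_diff algebra_simps of_nat_diff)
    moreover have "int (j - i - 1) * b \<in> X" by (rule j_in) simp
    ultimately show False using per b(2) by blast
  qed
  have cX: "c \<in> X" using stepc[of 0] zero by (auto simp: cong_sym_eq)
  show ?thesis
  proof (cases "\<exists>t\<le>j. [c = int t * b] (mod n)")
    case True
    then obtain t where t: "t \<le> j" "[c = int t * b] (mod n)" by blast
    have "t \<noteq> 0" using t(2) c0 by (metis cong_0_iff mult_zero_left of_nat_0)
    moreover have False if "t \<ge> 2"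
    proof -
      have lt: "j + 1 - t < j" using that t(1) by simp
      have "int (j + 1 - t) * b + c \<in> X"
        by (rule stepc[OF j_in before_s]) (use lt in simp_all)
      moreover have "int (j + 1 - t) * b + c - int (Suc j) * b = c - int t * b"
        using t(1) by (simp add: of_nat_diff algebra_simps)
      then have "[int (j + 1 - t) * b + c = int (Suc j) * b] (mod n)"
        using t(2) by (simp only: cong_iff_dvd_diff)
      ultimately show False using per j_out by blast
    qed
    ultimately have "t = 1" by (cases "t \<ge> 2") auto
    then show ?thesis using t(2) by (simp add: cong_sym_eq)
  next
    case False
    have c_walk: "c + int i * b \<in> X" for i
    proof (induction i rule: less_induct)
      case (less k)
      show ?case
      proof (cases k)
        case 0 then show ?thesis using cX by simp
      next
        case (Suc i)
        have "\<not> [c + int i * b = s] (mod n)"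
        proof
          assume "[c + int i * b = s] (mod n)"
          then have e: "[c + int i * b = int j * b] (mod n)" using j_s cong_sym cong_trans by blast
          show False
          proof (cases "i \<le> j")
            case True
            then have "[c = int (j - i) * b] (mod n)" using e
              by (simp add: cong_iff_dvd_diff algebra_simps of_nat_diff)
            then show False using False diff_le_self by blast
          next
            case f: False
            then have "[c + int (i - j - 1) * b = - b] (mod n)" using e
              by (simp add: cong_iff_dvd_diff algebra_simps of_nat_diff)
            moreover have "c + int (i - j - 1) * b \<in> X" using f Suc by (intro less.IH) simp
            ultimately show False using per b(2) by blast
          qed
        qed
        moreover have "c + int i * b \<in> X" using Suc by (intro less.IH) simp
        ultimately show ?thesis unfolding Suc using stepb[of "c + int i * b"] by (simp add: algebra_simps)
      qed
    qed
    have "int p * c + int i * b \<in> X" if "p \<ge> 1" for p i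
      using that
    proof (induction p arbitrary: i rule: dec_induct)
      case base then show ?case using c_walk by simp
    next
      case (step p)
      have "\<not> [int p * c + int i * b = s] (mod n)"
      proof
        assume "[int p * c + int i * b = s] (mod n)"
        then have e: "[int p * c + int i * b = int j * b] (mod n)" using j_s cong_sym cong_trans by blast
        \<comment> \<open>Adding \<open>(j + 1) b\<close> exactly \<open>n - 1\<close> times subtracts it, which leads from \<open>j b\<close> to \<open>- b\<close>.\<close>
        define m where "m = i + nat (n - 1) * (j + 1)"
        have "int m * b = int i * b + (n - 1) * (int j + 1) * b"
          unfolding m_def using n by (simp add: algebra_simps)
        then have "int p * c + int m * b - (- b) = (int p * c + int i * b - int j * b) + n * ((int j + 1) * b)"
          by (simp add: algebra_simps)
        then have "[int p * c + int m * b = - b] (mod n)"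
          using e unfolding cong_iff_dvd_diff by (metis dvd_add dvd_triv_left)
        then show False using per step.IH b(2) by blast
      qed
      then show ?case using stepc[OF step.IH, of i] by (simp add: algebra_simps)
    qed
    from this[of "nat n"] have "n * c + int i * b \<in> X" for i using n by simp
    moreover have "[n * c + int i * b = int i * b] (mod n)" for i by (simp add: cong_iff_dvd_diff)
    ultimately have False using full per by blast
    then show ?thesis ..
  qed
qed

text \<open>This holds for a term \<open>b\<close> outside \<open>T\<close> that creates only one new residue, and it still
holds after \<open>b\<close> has joined \<open>T\<close>. Then all residues may have become subset sums; \<open>- b\<close> is
one of them only as the full sum.\<close>
definition direction :: "int \<Rightarrow> ('i \<Rightarrow> int) \<Rightarrow> 'i set \<Rightarrow> int \<Rightarrow> bool" where
  "direction n a T b \<longleftrightarrow> closed_except n (subset_sums n a T) (sum a T) b \<and>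
     (- b \<in> subset_sums n a T \<longrightarrow> [sum a T = - b] (mod n))"

text \<open>If \<open>- b\<close> or \<open>- c\<close> is not a subset sum, then \<open>closed_except_step_unique\<close> applies;
otherwise both are congruent to the full sum.\<close>
lemma direction_unique:
  assumes "n > 0" "T \<noteq> {}" "zero_sum_free n a T" "\<not> n dvd b" "\<not> n dvd c"
    and "direction n a T b" "direction n a T c"
  shows "[b = c] (mod n)"
proof -
  let ?X = "subset_sums n a T"
  have s0: "\<not> [sum a T = 0] (mod n)"
    using assms(2,3) unfolding zero_sum_free_def cong_0_iff by blast
  note unique = closed_except_step_unique[OF subset_sums_cong zero_in_subset_sums s0 assms(1)]
  consider "- b \<notin> ?X" | "- c \<notin> ?X" | "- b \<in> ?X" "- c \<in> ?X" by blast
  then show ?thesis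
  proof cases
    case 1
    then show ?thesis using assms unfolding direction_def by (intro unique) auto
  next
    case 2
    then have "[c = b] (mod n)" using assms unfolding direction_def by (intro unique) auto
    then show ?thesis by (rule cong_sym)
  next
    case 3
    then have "[sum a T = - b] (mod n)" "[sum a T = - c] (mod n)"
      using assms(6,7) unfolding direction_def by blast+
    then have "[- b = - c] (mod n)" using cong_sym cong_trans by blast
    then show ?thesis by (simp add: cong_minus_minus_iff)
  qed
qed

lemma direction_cong:
  assumes "[b = c] (mod n)" "direction n a T b"
  shows "direction n a T c"
proof -
  have e: "[x + b = x + c] (mod n)" "[- b = - c] (mod n)" for x
    using assms(1) by (simp_all add: cong_add_lcancel cong_minus_minus_iff)
  have "- c \<in> subset_sums n a T \<longrightarrow> [sum a T = - c] (mod n)"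
  proof
    assume "- c \<in> subset_sums n a T"
    then have "- b \<in> subset_sums n a T" using subset_sums_cong[OF cong_sym[OF e(2)]] by blast
    then show "[sum a T = - c] (mod n)"
      using assms(2) cong_trans[OF _ e(2)] unfolding direction_def by blast
  qed
  moreover have "closed_except n (subset_sums n a T) (sum a T) c"
    using assms(2) subset_sums_cong[OF e(1)] unfolding direction_def closed_except_def by blast
  ultimately show ?thesis unfolding direction_def by blast
qed

text \<open>A further copy of \<open>b\<close> adds only the new end point of the progression, so the picture persists.\<close>
lemma direction_insert:
  assumes fin: "finite T" and i: "i \<notin> T" and free: "zero_sum_free n a (insert i T)"
    and dir: "direction n a T (a i)"
  shows "direction n a (insert i T) (a i)"
proof -
  let ?X = "subset_sums n a T" and ?Y = "subset_sums n a (insert i T)"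
  have Y: "?Y = ?X \<union> (\<lambda>x. x + a i) ` ?X" by (rule subset_sums_insert[OF fin i])
  have s: "sum a (insert i T) = sum a T + a i" using fin i by simp
  have step: "x + a i \<in> ?X" if "x \<in> ?X" "\<not> [x = sum a T] (mod n)" for x
    using dir that unfolding direction_def closed_except_def by blast
  have "closed_except n ?Y (sum a T + a i) (a i)"
    unfolding closed_except_def
  proof (intro ballI impI)
    fix y assume y: "y \<in> ?Y" "\<not> [y = sum a T + a i] (mod n)"
    have "y \<in> ?X"
    proof (rule ccontr)
      assume "y \<notin> ?X"
      then obtain x where x: "x \<in> ?X" "y = x + a i" using y(1) Y by blast
      then have "\<not> [x = sum a T] (mod n)" using y(2) by (simp add: cong_add_rcancel)
      then show False using step x \<open>y \<notin> ?X\<close> by blast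
    qed
    then show "y + a i \<in> ?Y" using Y by blast
  qed
  moreover have "[sum a T + a i = - a i] (mod n)" if "- a i \<in> ?Y"
  proof -
    have out: "- a i \<notin> ?X" by (rule neg_term_notin_subset_sums[OF fin i free])
    then have "- a i \<in> (\<lambda>x. x + a i) ` ?X" using that unfolding Y by (metis Un_iff)
    then obtain x where x: "x \<in> ?X" "- a i = x + a i" by (elim imageE)
    have "[x = sum a T] (mod n)"
      using step[OF x(1)] out x(2) by auto
    then have "[x + a i = sum a T + a i] (mod n)" by (simp add: cong_add_rcancel)
    then show ?thesis unfolding x(2) by (rule cong_sym)
  qed
  ultimately show ?thesis unfolding direction_def s by blast
qed

section \<open>Subsequences with many subset sums\<close>

text \<open>
The threshold is chosen such that a sequence of length greater than \<open>n / 2\<close> is too long to be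
heavy, although each of its single terms is.\<close>

definition heavy :: "int \<Rightarrow> ('i \<Rightarrow> int) \<Rightarrow> 'i set \<Rightarrow> bool" where
  "heavy n a T \<longleftrightarrow> 2 * card T \<le> residue_count n (subset_sums n a T)"

lemma heavy_singleton:
  assumes "n > 0" "\<not> n dvd a i"
  shows "heavy n a {i}"
proof -
  have "{0} \<union> {a i} \<subseteq> subset_sums n a {i}"
    using zero_in_subset_sums sum_in_subset_sums[of "{i}" "{i}" a n] by auto
  then have "residue_count n ({0} \<union> {a i}) \<le> residue_count n (subset_sums n a {i})"
    by (rule residue_count_mono[OF assms(1)])
  moreover have "residue_count n ({0} \<union> {a i}) = 2"
    using assms
    by (subst residue_count_Un_disjoint) (auto simp: residue_count_singleton cong_sym_eq[of 0] cong_0_iff)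
  ultimately show ?thesis unfolding heavy_def by simp
qed

text \<open>Let \<open>M\<close> be a maximal heavy subset that contains \<open>T\<close>; it is proper by length. By
maximality each remaining term creates a single new residue on top of \<open>M\<close>, so it is a
direction for \<open>M\<close>. All remaining terms are therefore congruent, and adding them one
by one keeps their common value a direction up to \<open>S\<close>.\<close>
lemma heavy_extends_to_direction:
  assumes n: "n > 0" and fin: "finite S" and free: "zero_sum_free n a S"
    and long: "n < 2 * int (card S)" and T: "T \<subseteq> S" "heavy n a T"
  shows "\<exists>i\<in>S - T. direction n a S (a i)"
proof -
  let ?F = "{M. T \<subseteq> M \<and> M \<subseteq> S \<and> heavy n a M}"
  have "finite ?F" by (rule finite_subset[of _ "Pow S"]) (use fin in auto)
  moreover have "T \<in> ?F" using T by blast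
  ultimately have "\<exists>M\<in>?F. T \<subseteq> M \<and> (\<forall>M'\<in>?F. M \<subseteq> M' \<longrightarrow> M = M')"
    by (rule finite_has_maximal2)
  then obtain M where M: "M \<in> ?F" and max': "\<forall>M'\<in>?F. M \<subseteq> M' \<longrightarrow> M = M'"
    by (elim bexE conjE)
  have max: "M' = M" if "M' \<in> ?F" "M \<subseteq> M'" for M'
    using bspec[OF max' that(1)] that(2) by simp
  have fM: "finite M" using M fin finite_subset by blast
  have "\<not> heavy n a S" using residue_count_le[OF n, of "subset_sums n a S"] long unfolding heavy_def by linarith
  then obtain i where i: "i \<in> S" "i \<notin> M" using M by (cases "M = S") auto
  have "M \<noteq> {}"
  proof
    assume "M = {}"
    moreover have "heavy n a {i}" by (intro heavy_singleton n zero_sum_free_term[OF free i(1)])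
    ultimately show False using max[of "{i}"] M i by blast
  qed
  have freeM: "zero_sum_free n a M" using zero_sum_free_subset[OF free] M by blast
  have dirM: "direction n a M (a j)" if j: "j \<in> S" "j \<notin> M" for j
  proof -
    have free': "zero_sum_free n a (insert j M)" using zero_sum_free_subset[OF free] M j(1) by blast
    have "\<not> heavy n a (insert j M)" using max[of "insert j M"] M j by blast
    then have "residue_count n (subset_sums n a (insert j M)) \<le> residue_count n (subset_sums n a M) + 1"
      using M fM j(2) unfolding heavy_def by auto
    then show ?thesis
      using closed_except_if_one_new_residue[OF n fM j(2) free']
        neg_term_notin_subset_sums[OF fM j(2) free'] unfolding direction_def by blast
  qed
  have same: "[a j = a i] (mod n)" if "j \<in> S" "j \<notin> M" for j
    using that i by (intro direction_unique[OF n \<open>M \<noteq> {}\<close> freeM] zero_sum_free_term[OF free] dirM) auto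
  have "direction n a (M \<union> Q) (a i)" if "Q \<subseteq> S - M" for Q
    using finite_subset[OF that] fin that
  proof (induction Q rule: infinite_finite_induct)
    case (insert j Q)
    have c: "[a i = a j] (mod n)" using same[of j] insert.prems by (auto intro: cong_sym)
    have "direction n a (M \<union> Q) (a j)" using insert direction_cong[OF c] by auto
    then have "direction n a (insert j (M \<union> Q)) (a j)"
      using insert fM M by (intro direction_insert zero_sum_free_subset[OF free]) auto
    then show ?case using direction_cong[OF cong_sym[OF c]] by simp
  qed (use dirM i in auto)
  from this[of "S - M"] have "direction n a S (a i)" using M by (simp add: Un_absorb1)
  then show ?thesis using i M by blast
qed

text \<open>Each heavy \<open>T\<close> leaves out some direction of \<open>S\<close>, and there is only one up to congruence. So
no heavy subset contains all copies of this term.\<close>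
lemma heavy_misses_direction:
  assumes n: "n > 0" and fin: "finite S" and free: "zero_sum_free n a S"
    and long: "n < 2 * int (card S)"
  obtains i where "i \<in> S"
    "\<And>T. T \<subseteq> S \<Longrightarrow> heavy n a T \<Longrightarrow> \<exists>j\<in>S - T. [a j = a i] (mod n)"
proof -
  have "heavy n a {}" by (simp add: heavy_def)
  then obtain i where i: "i \<in> S" "direction n a S (a i)"
    using heavy_extends_to_direction[OF assms, of "{}"] by auto
  have "\<exists>j\<in>S - T. [a j = a i] (mod n)" if T: "T \<subseteq> S" "heavy n a T" for T
  proof -
    obtain j where j: "j \<in> S - T" "direction n a S (a j)"
      using heavy_extends_to_direction[OF assms T] by blast
    have "[a j = a i] (mod n)"
      using i j by (intro direction_unique[OF n _ free] zero_sum_free_term[OF free]) auto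
    then show ?thesis using j(1) by blast
  qed
  then show thesis using that i(1) by blast
qed

section \<open>The structure of long zero-sum-free sequences\<close>

text \<open>
The subset sums are \<open>0, b, \<dots>, L b\<close>, pairwise incongruent, where \<open>L\<close> is the sum of the
coordinates as natural numbers. The last conjunct gives the incongruence and keeps
\<open>L\<close> below the order of \<open>b\<close>.\<close>

definition interval_coordinates ::
  "int \<Rightarrow> ('i \<Rightarrow> int) \<Rightarrow> int \<Rightarrow> 'i set \<Rightarrow> ('i \<Rightarrow> nat) \<Rightarrow> bool" where
  "interval_coordinates n a b A x \<longleftrightarrow>
     (\<forall>i\<in>A. 1 \<le> x i \<and> [a i = int (x i) * b] (mod n)) \<and>
     subset_sums n a A = {y. \<exists>t\<le>sum x A. [y = int t * b] (mod n)} \<and>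
     (\<forall>d. 1 \<le> d \<longrightarrow> d \<le> sum x A \<longrightarrow> \<not> n dvd int d * b)"

lemma interval_coordinates_empty: "interval_coordinates n a b {} x"
  unfolding interval_coordinates_def subset_sums_def by simp

text \<open>The intervals \<open>{0..L} b\<close> and \<open>{t..L + t} b\<close> overlap or touch because \<open>t \<le> L + 1\<close>. If
\<open>d b = 0\<close> for some \<open>d\<close> with \<open>L < d \<le> L + t\<close>, then \<open>(d - t) b = - a u\<close> would be a subset sum of
\<open>A\<close>, contrary to the absence of zero sums.\<close>
lemma interval_coordinates_insert:
  assumes A: "finite A" "u \<notin> A" and free: "zero_sum_free n a (insert u A)"
    and x: "interval_coordinates n a b A x"
    and t: "1 \<le> t" "t \<le> sum x A + 1" "[a u = int t * b] (mod n)"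
  shows "interval_coordinates n a b (insert u A) (x(u := t))"
proof -
  let ?X = "subset_sums n a A"
  define L where "L = sum x A"
  have X: "y \<in> ?X \<longleftrightarrow> (\<exists>s\<le>L. [y = int s * b] (mod n))" for y
    using x unfolding interval_coordinates_def L_def by blast
  have sum': "sum (x(u := t)) (insert u A) = L + t"
  proof -
    have "sum (x(u := t)) A = L" unfolding L_def using A(2) by (intro sum.cong) auto
    then show ?thesis using A by simp
  qed
  have shift: "[y + a u = int (s + t) * b] (mod n)" if "[y = int s * b] (mod n)" for y s
    using cong_add[OF that t(3)] by (simp add: algebra_simps)
  have sums: "subset_sums n a (insert u A) = {y. \<exists>s\<le>L + t. [y = int s * b] (mod n)}"
    unfolding subset_sums_insert[OF A]
  proof (intro equalityI subsetI)
    fix y assume "y \<in> ?X \<union> (\<lambda>y. y + a u) ` ?X"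
    then show "y \<in> {y. \<exists>s\<le>L + t. [y = int s * b] (mod n)}"
    proof
      assume "y \<in> ?X"
      then obtain s where "s \<le> L" "[y = int s * b] (mod n)" using X by blast
      then show ?thesis by (intro CollectI exI[of _ s]) auto
    next
      assume "y \<in> (\<lambda>y. y + a u) ` ?X"
      then obtain z where z: "z \<in> ?X" "y = z + a u" by (elim imageE)
      then obtain s where "s \<le> L" "[z = int s * b] (mod n)" using X by blast
      then show ?thesis using shift z(2) by (intro CollectI exI[of _ "s + t"]) auto
    qed
  next
    fix y assume "y \<in> {y. \<exists>s\<le>L + t. [y = int s * b] (mod n)}"
    then obtain s where s: "s \<le> L + t" "[y = int s * b] (mod n)" by blast
    show "y \<in> ?X \<union> (\<lambda>y. y + a u) ` ?X"
    proof (cases "s \<le> L")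
      case True
      then show ?thesis using s X by blast
    next
      case False
      then have "t \<le> s" using t(2) unfolding L_def by simp
      then have "int s * b - int t * b = int (s - t) * b"
        by (simp add: of_nat_diff algebra_simps)
      then have "[y - a u = int (s - t) * b] (mod n)"
        using cong_diff[OF s(2) t(3)] by simp
      then have "y - a u \<in> ?X" using X s(1) by (metis le_diff_conv)
      then show ?thesis by (intro UnI2 image_eqI[of _ _ "y - a u"]) auto
    qed
  qed
  have "\<not> n dvd int d * b" if d: "1 \<le> d" "d \<le> L + t" for d
  proof (cases "d \<le> L")
    case True
    then show ?thesis using x d unfolding interval_coordinates_def L_def by blast
  next
    case False
    show ?thesis
    proof
      assume "n dvd int d * b"
      then have "[int d * b = 0] (mod n)" by (simp add: cong_0_iff)
      moreover have "t \<le> d" using False t(2) unfolding L_def by simp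
      then have "int d * b - int t * b = int (d - t) * b"
        by (simp add: of_nat_diff algebra_simps)
      ultimately have "[int (d - t) * b = - a u] (mod n)"
        using cong_diff[OF \<open>[int d * b = 0] (mod n)\<close> cong_sym[OF t(3)]] by simp
      then have "- a u \<in> ?X" using X d(2) cong_sym by (metis le_diff_conv)
      then show False using neg_term_notin_subset_sums[OF A free] by blast
    qed
  qed
  moreover have "1 \<le> (x(u := t)) i \<and> [a i = int ((x(u := t)) i) * b] (mod n)" if "i \<in> insert u A" for i
    using that x t unfolding interval_coordinates_def by auto
  ultimately show ?thesis unfolding interval_coordinates_def sum' sums by blast
qed

lemma residue_count_interval_coordinates:
  assumes "n > 0" "interval_coordinates n a b A x"
  shows "sum x A < residue_count n (subset_sums n a A)"
proof -
  let ?f = "\<lambda>t. (int t * b) mod n" and ?L = "sum x A"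
  have "inj_on ?f {..?L}"
  proof (rule linorder_inj_onI')
    fix s t assume st: "s \<in> {..?L}" "t \<in> {..?L}" "s < t"
    show "?f s \<noteq> ?f t"
    proof
      assume "?f s = ?f t"
      then have "n dvd int t * b - int s * b" unfolding mod_eq_dvd_iff[symmetric] by (rule sym)
      moreover have "int t * b - int s * b = int (t - s) * b"
        using st(3) by (simp add: of_nat_diff algebra_simps)
      ultimately have "n dvd int (t - s) * b" by simp
      moreover have "1 \<le> t - s" "t - s \<le> ?L" using st by auto
      ultimately show False using assms(2) unfolding interval_coordinates_def by blast
    qed
  qed
  then have "card (?f ` {..?L}) = ?L + 1" by (simp add: card_image)
  moreover have "?f ` {..?L} \<subseteq> (\<lambda>y. y mod n) ` subset_sums n a A"
  proof (intro image_subsetI image_eqI[OF refl])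
    fix t assume "t \<in> {..?L}"
    then show "int t * b \<in> subset_sums n a A"
      using assms(2) cong_refl unfolding interval_coordinates_def by blast
  qed
  ultimately show ?thesis
    unfolding residue_count_def using card_mono[OF finite_residue_image[OF assms(1)]]
    by (metis Suc_eq_plus1 Suc_le_eq)
qed

text \<open>The subset sums of \<open>A\<close> and their translate by \<open>a u\<close> are disjoint: a coincidence makes
\<open>a u\<close> or \<open>- a u\<close> a small multiple of \<open>b\<close>. The first is excluded by assumption and the
second would complete a zero sum. So the number of residues, at least \<open>card A + 1\<close>, doubles.\<close>
lemma heavy_insert_outside_interval:
  assumes n: "n > 0" and A: "finite A" "u \<notin> A" and free: "zero_sum_free n a (insert u A)"
    and x: "interval_coordinates n a b A x"
    and out: "\<And>t. 1 \<le> t \<Longrightarrow> t \<le> sum x A \<Longrightarrow> \<not> [a u = int t * b] (mod n)"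
  shows "heavy n a (insert u A)"
proof -
  let ?X = "subset_sums n a A"
  have X: "y \<in> ?X \<longleftrightarrow> (\<exists>s\<le>sum x A. [y = int s * b] (mod n))" for y
    using x unfolding interval_coordinates_def by blast
  have disj: "\<not> [y = z] (mod n)" if y: "y \<in> ?X" and z: "z \<in> (\<lambda>y. y + a u) ` ?X" for y z
  proof
    assume yz: "[y = z] (mod n)"
    obtain w where w: "w \<in> ?X" "z = w + a u" using z by (elim imageE)
    obtain s where s: "s \<le> sum x A" "[y = int s * b] (mod n)" using y X by blast
    obtain t where t: "t \<le> sum x A" "[w = int t * b] (mod n)" using w(1) X by blast
    have "[y - w = a u] (mod n)" using cong_diff[OF yz cong_refl[of w]] w(2) by simp
    then have e: "[a u = int s * b - int t * b] (mod n)"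
      using cong_diff[OF s(2) t(2)] cong_sym cong_trans by blast
    show False
    proof (cases "t < s")
      case True
      then have "int s * b - int t * b = int (s - t) * b"
        by (simp add: of_nat_diff algebra_simps)
      then have "[a u = int (s - t) * b] (mod n)" using e by metis
      moreover have "1 \<le> s - t" "s - t \<le> sum x A" using True s(1) by auto
      ultimately show False using out by blast
    next
      case False
      then have "- (int s * b - int t * b) = int (t - s) * b"
        by (simp add: of_nat_diff algebra_simps)
      then have "[- a u = int (t - s) * b] (mod n)"
        using e cong_minus_minus_iff by metis
      then have "- a u \<in> ?X" using X t(1) by (meson diff_le_self le_trans)
      then show False using neg_term_notin_subset_sums[OF A free] by blast
    qed
  qed
  have "card A \<le> sum x A"
    using x sum_mono[of A "\<lambda>_. 1" x] unfolding interval_coordinates_def by auto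
  then have "card A + 1 \<le> residue_count n ?X" using residue_count_interval_coordinates[OF n x] by linarith
  moreover have "residue_count n (subset_sums n a (insert u A)) = 2 * residue_count n ?X"
    unfolding subset_sums_insert[OF A] using residue_count_Un_disjoint[OF n disj]
    by (simp add: residue_count_shift)
  ultimately show ?thesis unfolding heavy_def using A by simp
qed

text \<open>The theorem of Savchev and Chen. Take as \<open>b\<close> the term whose copies no heavy subset exhausts, and
a maximal set \<open>A\<close> with interval coordinates along \<open>b\<close>. It contains all copies of \<open>b\<close>, since these
can be inserted with coordinate \<open>1\<close>. A term \<open>u\<close> outside \<open>A\<close> that cannot be inserted makes \<open>insert u A\<close>
heavy, which is impossible as this set contains all copies of \<open>b\<close>.\<close>
theorem long_zero_sum_free_coordinates:
  assumes n: "n > 0" and fin: "finite S" and free: "zero_sum_free n a S"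
    and long: "n < 2 * int (card S)"
  shows "\<exists>b x. (\<forall>i\<in>S. 1 \<le> x i \<and> [a i = int (x i) * b] (mod n)) \<and> int (sum x S) < n"
proof -
  obtain i where i: "i \<in> S"
    and misses: "\<And>T. T \<subseteq> S \<Longrightarrow> heavy n a T \<Longrightarrow> \<exists>j\<in>S - T. [a j = a i] (mod n)"
    using heavy_misses_direction[OF assms] by blast
  let ?F = "{A. A \<subseteq> S \<and> (\<exists>x. interval_coordinates n a (a i) A x)}"
  have "finite ?F" by (rule finite_subset[of _ "Pow S"]) (use fin in auto)
  moreover have "{} \<in> ?F" using interval_coordinates_empty by blast
  ultimately have "\<exists>A\<in>?F. {} \<subseteq> A \<and> (\<forall>A'\<in>?F. A \<subseteq> A' \<longrightarrow> A = A')"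
    by (rule finite_has_maximal2)
  then obtain A where A: "A \<in> ?F" and max: "\<forall>A'\<in>?F. A \<subseteq> A' \<longrightarrow> A = A'" by (elim bexE conjE)
  from A obtain x where x: "A \<subseteq> S" "interval_coordinates n a (a i) A x" by blast
  have finA: "finite A" using x(1) fin finite_subset by blast
  have free': "zero_sum_free n a (insert u A)" if "u \<in> S" for u
    using that x(1) by (intro zero_sum_free_subset[OF free]) auto
  have stuck: "\<not> [a u = int t * a i] (mod n)"
    if "u \<in> S" "u \<notin> A" "1 \<le> t" "t \<le> sum x A + 1" for u t
  proof
    assume "[a u = int t * a i] (mod n)"
    then have "interval_coordinates n a (a i) (insert u A) (x(u := t))"
      using that by (intro interval_coordinates_insert finA free' x(2))
    then have "insert u A \<in> ?F" using that(1) x(1) by blast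
    then have "A = insert u A" using bspec[OF max] by blast
    then show False using that(2) by blast
  qed
  have "A = S"
  proof (rule ccontr)
    assume "A \<noteq> S"
    then obtain u where u: "u \<in> S" "u \<notin> A" using x(1) by blast
    have "heavy n a (insert u A)"
      using u stuck by (intro heavy_insert_outside_interval[OF n finA _ free' x(2)]) auto
    then obtain j where j: "j \<in> S - insert u A" "[a j = a i] (mod n)"
      using misses[of "insert u A"] u x(1) by blast
    then show False using stuck[of j 1] by simp
  qed
  moreover have "int (sum x A) < n"
  proof (rule ccontr)
    assume "\<not> int (sum x A) < n"
    then have "nat n \<ge> 1" "nat n \<le> sum x A" using n by linarith+
    then have "\<not> n dvd int (nat n) * a i" using x(2) unfolding interval_coordinates_def by blast
    then show False using n by simp
  qed
  ultimately show ?thesis using x(2) unfolding interval_coordinates_def by blast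
qed

section \<open>Sequences with many distinct terms\<close>

text \<open>
The numbers \<open>x i - 1\<close> take at least \<open>k\<close> different values, so their sum is at least
\<open>0 + 1 + \<dots> + (k - 1)\<close>.\<close>

lemma sum_ge_with_distinct_values:
  fixes x :: "'i \<Rightarrow> nat"
  assumes "finite S" "\<And>i. i \<in> S \<Longrightarrow> 1 \<le> x i" "k \<le> card (x ` S)"
  shows "card S + k * (k - 1) div 2 \<le> sum x S"
proof -
  let ?y = "\<lambda>i. x i - 1"
  have "1 \<le> m" if "m \<in> x ` S" for m using assms(2) that by blast
  then have "inj_on (\<lambda>m::nat. m - 1) (x ` S)" by (intro inj_onI) (metis le_add_diff_inverse2)
  then have "card (?y ` S) = card (x ` S)"
    using card_image[of "\<lambda>m. m - 1" "x ` S"] by (simp add: image_image)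
  then have "\<Sum>{0..<k} \<le> \<Sum>{0..<card (?y ` S)}"
    using assms(3) by (intro sum_mono2) auto
  also have "\<dots> \<le> \<Sum>(?y ` S)" by (rule card_sum_le_nat_sum)
  also have "\<dots> \<le> sum ?y S"
    using sum_image_le[OF assms(1), of "\<lambda>m. m" ?y] by simp
  finally have "k * (k - 1) div 2 \<le> sum ?y S"
    using gauss_sum_nat[of "k - 1"] by (cases k)
      (simp_all add: atLeast0LessThan lessThan_Suc_atMost atLeast0AtMost mult.commute)
  moreover have "sum x S = card S + sum ?y S"
  proof -
    have "sum x S = (\<Sum>i\<in>S. 1 + ?y i)" by (rule sum.cong[OF refl]) (metis assms(2) le_add_diff_inverse)
    then show ?thesis by (simp only: sum.distrib) simp
  qed
  ultimately show ?thesis by simp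
qed

lemma zero_sum_iff_not_zero_sum_free:
  assumes "n > 0" "set xs \<subseteq> carrier (integer_mod_group n)"
  shows "contains_nonempty_zero_sum (integer_mod_group n) xs \<longleftrightarrow>
    \<not> zero_sum_free (int n) (\<lambda>i. xs ! i) {..<length xs}"
proof -
  have "finprod (integer_mod_group n) (\<lambda>i. xs ! i) I = (\<Sum>i\<in>I. xs ! i) mod int n"
    if "I \<subseteq> {..<length xs}" for I
  proof (rule finprod_integer_mod_group[OF assms(1) finite_subset[OF that finite_lessThan]])
    fix i assume "i \<in> I"
    then have "i < length xs" using that by blast
    then show "xs ! i \<in> carrier (integer_mod_group n)" by (rule subsetD[OF assms(2) nth_mem])
  qed
  then have "finprod (integer_mod_group n) (\<lambda>i. xs ! i) I = \<one>\<^bsub>integer_mod_group n\<^esub>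
      \<longleftrightarrow> int n dvd (\<Sum>i\<in>I. xs ! i)" if "I \<subseteq> {..<length xs}" for I
    using that by (simp add: mod_eq_0_iff_dvd)
  then show ?thesis
    unfolding contains_nonempty_zero_sum_def zero_sum_free_def by blast
qed

text \<open>The values of \<open>a\<close> are determined by the coordinates of \<open>long_zero_sum_free_coordinates\<close>, so these
have at least \<open>k\<close> different values as well, and their sum is less than \<open>n\<close>.\<close>
lemma zero_sum_free_length_bound:
  assumes n: "n > 0" and S: "finite S" and free: "zero_sum_free (int n) a S"
    and distinct: "k \<le> card (a ` S)" and range: "a ` S \<subseteq> {0..<int n}"
    and long: "n < 2 * card S"
  shows "card S + k * (k - 1) div 2 < n"
proof -
  obtain b x where x: "\<And>i. i \<in> S \<Longrightarrow> 1 \<le> x i" "\<And>i. i \<in> S \<Longrightarrow> [a i = int (x i) * b] (mod int n)"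
      "int (sum x S) < int n"
    using long_zero_sum_free_coordinates[OF _ S free] n long by auto
  have "a i = (int (x i) * b) mod int n" if "i \<in> S" for i
    using x(2)[OF that] range that unfolding cong_def
    by (metis atLeastLessThan_iff image_subset_iff mod_pos_pos_trivial)
  then have "a ` S = (\<lambda>m. (int m * b) mod int n) ` x ` S" unfolding image_image by (rule image_cong[OF refl])
  then have "card (a ` S) \<le> card (x ` S)" using card_image_le[of "x ` S"] S by simp
  then have "card S + k * (k - 1) div 2 \<le> sum x S"
    using distinct x(1) by (intro sum_ge_with_distinct_values[OF S]) auto
  moreover have "sum x S < n" using x(3) by (simp only: of_nat_less_iff)
  ultimately show ?thesis by linarith
qed

text \<open>The sequence \<open>1, 2, \<dots>, k\<close> followed by ones. Its terms are positive with total below \<open>n\<close>.\<close>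
lemma exists_zero_sum_free_sequence:
  assumes k: "k > 0" "k \<le> l" and l: "l + k * (k - 1) div 2 < n"
  shows "\<exists>xs. set xs \<subseteq> carrier (integer_mod_group n) \<and> k \<le> card (set xs) \<and> length xs = l \<and>
    zero_sum_free (int n) (\<lambda>i. xs ! i) {..<length xs}"
proof -
  define xs where "xs = map int [1..<Suc k] @ replicate (l - k) (1::int)"
  have len: "length xs = l" unfolding xs_def using k by simp
  have "sum_list (map int [1..<Suc k]) = int (\<Sum>{1..<Suc k})"
    by (metis (no_types) atLeastLessThan_upt distinct_upt int_sum map_map sum_list_distinct_conv_sum_set set_upt sum.cong)
  also have "\<Sum>{1..<Suc k} = (k * (k - 1) + k * 2) div 2"
  proof -
    have "2 * \<Sum>{1..<Suc m} = m * (m - 1) + m * 2" for m :: nat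
    proof (induction m)
      case (Suc m)
      then show ?case by (cases m) simp_all
    qed simp
    then show ?thesis by (metis nonzero_mult_div_cancel_left zero_neq_numeral)
  qed
  also have "(k * (k - 1) + k * 2) div 2 = k * (k - 1) div 2 + k" by simp
  finally have "sum_list xs = int (l + k * (k - 1) div 2)"
    unfolding xs_def using k by (simp add: sum_list_replicate of_nat_diff)
  then have total: "(\<Sum>i<length xs. xs ! i) < int n"
    using l by (simp add: sum_list_sum_nth atLeast0LessThan)
  have pos: "1 \<le> xs ! i" if "i < length xs" for i
    using that nth_mem[OF that] unfolding xs_def by auto
  have "zero_sum_free (int n) (\<lambda>i. xs ! i) {..<length xs}"
    unfolding zero_sum_free_def
  proof (intro allI impI)
    fix U assume U: "U \<subseteq> {..<length xs}" "int n dvd (\<Sum>i\<in>U. xs ! i)"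
    have "(\<Sum>i\<in>U. xs ! i) \<le> (\<Sum>i<length xs. xs ! i)"
      using U(1) pos by (intro sum_mono2) (auto intro: order_trans[OF zero_le_one])
    then have "\<not> 0 < (\<Sum>i\<in>U. xs ! i)" using U(2) total zdvd_imp_le by fastforce
    moreover have "int (card U) \<le> (\<Sum>i\<in>U. xs ! i)"
      using sum_mono[of U "\<lambda>_. 1" "\<lambda>i. xs ! i"] pos U(1) by auto
    ultimately have "card U = 0" by simp
    then show "U = {}" using finite_subset[OF U(1)] by simp
  qed
  moreover have "k \<le> card (set xs)"
  proof -
    have "card (int ` {1..<Suc k}) = k" by (simp add: card_image)
    moreover have "int ` {1..<Suc k} \<subseteq> set xs" unfolding xs_def by auto
    ultimately show ?thesis by (metis List.finite_set card_mono)
  qed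
  moreover have "set xs \<subseteq> carrier (integer_mod_group n)"
  proof -
    have "k < n"
      using k l by linarith
    then show ?thesis unfolding xs_def carrier_integer_mod_group using k by auto
  qed
  ultimately show ?thesis using len by blast
qed

theorem proposition13:
  fixes n k :: nat
  assumes "n > 1"
    and "k > 0"
    and "k \<le> n"
    and "real k \<le> (sqrt (4 * real n - 3) + 1) / 2"
  shows "real (h n k) = real n - 1 / 2 * ((real k)\<^sup>2 - real k)"
proof -
  define d where "d = k * (k - 1) div 2"
  have "even (k * (k - 1))" by (cases k) auto
  then have d2: "2 * d = k * (k - 1)" unfolding d_def by simp
  then have "real (2 * d) = real (k * (k - 1))" by (simp only:)
  then have d_real: "2 * real d = (real k)\<^sup>2 - real k"
    using assms(2) by (simp add: of_nat_diff power2_eq_square right_diff_distrib)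
  \<comment> \<open>Squared, the bound on \<open>k\<close> reads \<open>k\<^sup>2 - k + 1 \<le> n\<close>, which puts \<open>n - d\<close> above \<open>n / 2\<close>.\<close>
  have "2 * real k - 1 \<le> sqrt (4 * real n - 3)" using assms(4) by simp
  then have "(2 * real k - 1)\<^sup>2 \<le> (sqrt (4 * real n - 3))\<^sup>2"
    using assms(2) by (intro power_mono) auto
  also have "\<dots> = 4 * real n - 3" using assms(1) by simp
  finally have "(real k)\<^sup>2 - real k + 1 \<le> real n" by (simp add: power2_eq_square algebra_simps)
  then have nd: "2 * d + 1 \<le> n" using d_real by linarith
  have "k \<le> d + 1"
  proof (cases "k = 1")
    case False
    then have "2 * (k - 1) \<le> k * (k - 1)" using assms(2) by (intro mult_right_mono) auto
    then show ?thesis using d2 by linarith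
  qed simp
  then have kN: "k \<le> n - d" using nd by linarith
  have "h n k = n - d"
    unfolding h_def
  proof (rule Least_equality)
    show "k \<le> n - d \<and> (\<forall>xs. set xs \<subseteq> carrier (integer_mod_group n) \<and> k \<le> card (set xs) \<and>
        length xs = n - d \<longrightarrow> contains_nonempty_zero_sum (integer_mod_group n) xs)"
    proof (intro conjI allI impI kN)
      fix xs :: "int list"
      assume xs: "set xs \<subseteq> carrier (integer_mod_group n) \<and> k \<le> card (set xs) \<and> length xs = n - d"
      show "contains_nonempty_zero_sum (integer_mod_group n) xs"
      proof (rule ccontr)
        assume "\<not> contains_nonempty_zero_sum (integer_mod_group n) xs"
        then have free: "zero_sum_free (int n) (\<lambda>i. xs ! i) {..<length xs}"
          using zero_sum_iff_not_zero_sum_free[of n xs] assms(1) xs by simp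
        have img: "(\<lambda>i. xs ! i) ` {..<length xs} = set xs"
          by (auto simp: set_conv_nth)
        have "card {..<length xs} + k * (k - 1) div 2 < n"
          by (rule zero_sum_free_length_bound[OF _ _ free, unfolded img])
            (use assms(1) xs nd in \<open>simp_all add: carrier_integer_mod_group\<close>)
        then show False using xs nd unfolding d_def by simp
      qed
    qed
  next
    fix l assume l: "k \<le> l \<and> (\<forall>xs. set xs \<subseteq> carrier (integer_mod_group n) \<and> k \<le> card (set xs) \<and>
        length xs = l \<longrightarrow> contains_nonempty_zero_sum (integer_mod_group n) xs)"
    show "n - d \<le> l"
    proof (rule ccontr)
      assume "\<not> n - d \<le> l"
      then have "l + k * (k - 1) div 2 < n" unfolding d_def by simp
      then obtain xs where "set xs \<subseteq> carrier (integer_mod_group n)" "k \<le> card (set xs)" "length xs = l"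
          "zero_sum_free (int n) (\<lambda>i. xs ! i) {..<length xs}"
        using exists_zero_sum_free_sequence[OF assms(2), of l n] l by blast
      then show False using l zero_sum_iff_not_zero_sum_free[of n xs] assms(1) by auto
    qed
  qed
  then show ?thesis using nd d_real by (simp add: of_nat_diff)
qed

end
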